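(* Let $n\ge 4$ and let $P(2n+1,1)$ be the graph with vertex set $\{u_0,\dots,u_{2n},v_0,\dots,v_{2n}\}$ and edges $u_iu_{i+1}$, $v_iv_{i+1}$, $u_iv_i$ ($i=0,\dots,2n$, indices mod $2n+1$). Up to switching isomorphism, the number of matchings of $P(2n+1,1)$ of size two is $4n-1$; that is, the matchings of size two of $P(2n+1,1)$, regarded as signatures, fall into exactly $4n-1$ classes under switching isomorphism.
   Context: A matching of size $k$ is a set of $k$ pairwise vertex-disjoint edges. A signature of a graph $G$ is a subset $\Sigma\subseteq E(G)$ (the negative edges). Resigning at a vertex $v$ replaces $\Sigma$ by its symmetric difference with the set of edges incident with $v$; two signatures are switching equivalent if one is obtained from the other by a sequence of resignings. Two signatures $\Sigma_1,\Sigma_2$ of $G$ are switching isomorphic if there is an automorphism $\psi$ of $G$ such that $\psi(\Sigma_1)=\{\psi(x)\psi(y):xy\in\Sigma_1\}$ is switching equivalent to $\Sigma_2$. *)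

theory Defs
  imports Main
begin

record 'a graph =
  verts :: "'a set"
  edges :: "'a set set"

definition simple_graph :: "'a graph \<Rightarrow> bool" where
  "simple_graph G \<longleftrightarrow> (\<forall>e\<in>edges G. e \<subseteq> verts G \<and> card e = 2)"

text \<open>Only the values of \<open>\<psi>\<close> on the vertices of the graph matter.\<close>

definition automorphism :: "'a graph \<Rightarrow> ('a \<Rightarrow> 'a) \<Rightarrow> bool" where
  "automorphism G \<psi> \<longleftrightarrow>
     bij_betw \<psi> (verts G) (verts G) \<and>
     (\<forall>x\<in>verts G. \<forall>y\<in>verts G. {x, y} \<in> edges G \<longleftrightarrow> {\<psi> x, \<psi> y} \<in> edges G)"

definition matchings :: "'a graph \<Rightarrow> nat \<Rightarrow> 'a set set set" where
  "matchings G k = {M. M \<subseteq> edges G \<and> finite M \<and> card M = k \<and> pairwise disjnt M}"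

definition signatures :: "'a graph \<Rightarrow> 'a set set set" where
  "signatures G = Pow (edges G)"

definition resign :: "'a graph \<Rightarrow> 'a \<Rightarrow> 'a set set \<Rightarrow> 'a set set" where
  "resign G v S = sym_diff S {e \<in> edges G. v \<in> e}"

definition switching_equivalent :: "'a graph \<Rightarrow> 'a set set \<Rightarrow> 'a set set \<Rightarrow> bool" where
  "switching_equivalent G = (\<lambda>S T. \<exists>v\<in>verts G. T = resign G v S)\<^sup>*\<^sup>*"

definition switching_isomorphic :: "'a graph \<Rightarrow> 'a set set \<Rightarrow> 'a set set \<Rightarrow> bool" where
  "switching_isomorphic G S T \<longleftrightarrow>
     (\<exists>\<psi>. automorphism G \<psi> \<and> switching_equivalent G ((`) \<psi> ` S) T)"

definition switching_iso_rel :: "'a graph \<Rightarrow> 'a set set set \<Rightarrow> ('a set set \<times> 'a set set) set" where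
  "switching_iso_rel G \<S> = {(S, T). S \<in> \<S> \<and> T \<in> \<S> \<and> switching_isomorphic G S T}"

datatype gp_vertex = U nat | V nat

definition gen_petersen :: "nat \<Rightarrow> nat \<Rightarrow> gp_vertex graph" where
  "gen_petersen m k = \<lparr>
     verts = U ` {..<m} \<union> V ` {..<m},
     edges = (\<Union>i<m. {{U i, U ((i + 1) mod m)}, {V i, V ((i + k) mod m)}, {U i, V i}})\<rparr>"

lemma simple_graph_gen_petersen:
  assumes "0 < k" "k < m"
  shows "simple_graph (gen_petersen m k)"
proof -
  have "(i + j) mod m \<noteq> i" if "i < m" "0 < j" "j < m" for i j
    using that by (cases "i + j < m") (auto simp: mod_if)
  note ne = this
  show ?thesis
    unfolding simple_graph_def
  proof (intro ballI conjI)
    fix e assume "e \<in> edges (gen_petersen m k)"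
    then obtain i where i: "i < m"
      and e: "e = {U i, U ((i + 1) mod m)} \<or> e = {V i, V ((i + k) mod m)} \<or> e = {U i, V i}"
      by (auto simp: gen_petersen_def)
    show "e \<subseteq> verts (gen_petersen m k)"
      using e i assms by (auto simp: gen_petersen_def)
    show "card e = 2"
      using e ne[OF i, of 1] ne[OF i, of k] assms by (elim disjE) simp_all
  qed
qed

lemma resign_resign: "resign G v (resign G v S) = S"
  by (auto simp: resign_def)

lemma resign_subset: "S \<subseteq> edges G \<Longrightarrow> resign G v S \<subseteq> edges G"
  by (auto simp: resign_def)

lemma switching_equivalent_refl: "switching_equivalent G S S"
  by (simp add: switching_equivalent_def)

lemma switching_equivalent_trans:
  "switching_equivalent G R S \<Longrightarrow> switching_equivalent G S T \<Longrightarrow> switching_equivalent G R T"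
  by (simp add: switching_equivalent_def)

lemma switching_equivalent_sym:
  assumes "switching_equivalent G S T"
  shows "switching_equivalent G T S"
proof -
  have "symp (\<lambda>S T. \<exists>v\<in>verts G. T = resign G v S)"
  proof (rule sympI, elim bexE)
    fix S T v assume "v \<in> verts G" "T = resign G v S"
    then show "\<exists>v\<in>verts G. S = resign G v T"
      by (intro bexI[of _ v]) (simp_all add: resign_resign)
  qed
  from sympD[OF symp_rtranclp[OF this]] show ?thesis
    using assms unfolding switching_equivalent_def .
qed

lemma automorphism_bij: "automorphism G \<psi> \<Longrightarrow> bij_betw \<psi> (verts G) (verts G)"
  by (simp add: automorphism_def)

lemma automorphism_vert: "automorphism G \<psi> \<Longrightarrow> x \<in> verts G \<Longrightarrow> \<psi> x \<in> verts G"
  using automorphism_bij by (metis bij_betwE)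

lemma automorphism_pair:
  "automorphism G \<psi> \<Longrightarrow> x \<in> verts G \<Longrightarrow> y \<in> verts G \<Longrightarrow>
     {\<psi> x, \<psi> y} \<in> edges G \<longleftrightarrow> {x, y} \<in> edges G"
  unfolding automorphism_def by blast

lemma automorphism_id: "automorphism G id"
  by (simp add: automorphism_def)

lemma automorphism_comp:
  assumes "automorphism G \<phi>" "automorphism G \<psi>"
  shows "automorphism G (\<phi> \<circ> \<psi>)"
  unfolding automorphism_def[of G "\<phi> \<circ> \<psi>"]
proof (intro conjI ballI)
  show "bij_betw (\<phi> \<circ> \<psi>) (verts G) (verts G)"
    using assms[THEN automorphism_bij] by (metis bij_betw_trans)
  show "{x, y} \<in> edges G \<longleftrightarrow> {(\<phi> \<circ> \<psi>) x, (\<phi> \<circ> \<psi>) y} \<in> edges G"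
    if "x \<in> verts G" "y \<in> verts G" for x y
    using that assms by (simp add: automorphism_pair automorphism_vert)
qed

lemma automorphism_inv:
  assumes "automorphism G \<psi>"
  shows "automorphism G (inv_into (verts G) \<psi>)"
proof -
  let ?\<phi> = "inv_into (verts G) \<psi>"
  have b: "bij_betw \<psi> (verts G) (verts G)"
    using assms by (rule automorphism_bij)
  have v: "?\<phi> x \<in> verts G" "\<psi> (?\<phi> x) = x" if "x \<in> verts G" for x
    using b that by (auto simp: bij_betw_def inv_into_into f_inv_into_f)
  show ?thesis
    unfolding automorphism_def
  proof (intro conjI ballI)
    show "bij_betw ?\<phi> (verts G) (verts G)"
      using b by (rule bij_betw_inv_into)
    show "{x, y} \<in> edges G \<longleftrightarrow> {?\<phi> x, ?\<phi> y} \<in> edges G"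
      if "x \<in> verts G" "y \<in> verts G" for x y
      using automorphism_pair[OF assms v(1)[OF that(1)] v(1)[OF that(2)]] v(2) that by simp
  qed
qed

lemma automorphism_edge:
  assumes "simple_graph G" "automorphism G \<psi>" "e \<in> edges G"
  shows "\<psi> ` e \<in> edges G"
proof -
  obtain x y where "e = {x, y}"
    using assms by (auto simp: simple_graph_def card_2_iff)
  then show ?thesis
    using assms automorphism_pair[OF assms(2), of x y] by (auto simp: simple_graph_def)
qed

lemma automorphism_image_inv:
  assumes "simple_graph G" "automorphism G \<psi>" "e \<in> edges G"
  shows "inv_into (verts G) \<psi> ` (\<psi> ` e) = e" and "\<psi> ` (inv_into (verts G) \<psi> ` e) = e"
proof -
  have e: "e \<subseteq> verts G" and b: "bij_betw \<psi> (verts G) (verts G)"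
    using assms automorphism_bij by (auto simp: simple_graph_def)
  show "inv_into (verts G) \<psi> ` (\<psi> ` e) = e"
    using b e by (auto simp: bij_betw_def inv_into_image_cancel)
  show "\<psi> ` (inv_into (verts G) \<psi> ` e) = e"
    using b e by (auto simp: bij_betw_def image_inv_into_cancel)
qed

lemma resign_automorphism:
  assumes G: "simple_graph G" "automorphism G \<psi>" and "S \<subseteq> edges G" "v \<in> verts G"
  shows "(`) \<psi> ` resign G v S = resign G (\<psi> v) ((`) \<psi> ` S)"
proof -
  let ?\<phi> = "inv_into (verts G) \<psi>"
  have inj: "inj_on ((`) \<psi>) (edges G)"
    using automorphism_image_inv(1)[OF G] by (metis inj_on_inverseI)
  have inc: "\<psi> v \<in> \<psi> ` e \<longleftrightarrow> v \<in> e" if "e \<in> edges G" for e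
  proof -
    have "inj_on \<psi> (verts G)" "e \<subseteq> verts G"
      using G that automorphism_bij by (auto simp: simple_graph_def bij_betw_def)
    then show ?thesis
      using \<open>v \<in> verts G\<close> by (simp add: inj_on_image_mem_iff)
  qed
  have star: "(`) \<psi> ` {e \<in> edges G. v \<in> e} = {e \<in> edges G. \<psi> v \<in> e}" (is "?L = ?R")
  proof
    show "?L \<subseteq> ?R" using automorphism_edge[OF G] by auto
    show "?R \<subseteq> ?L"
    proof
      fix e assume e: "e \<in> ?R"
      then have "?\<phi> ` e \<in> edges G"
        using automorphism_edge[OF G(1) automorphism_inv[OF G(2)]] by auto
      moreover have "\<psi> ` (?\<phi> ` e) = e"
        using automorphism_image_inv(2)[OF G] e by auto
      ultimately show "e \<in> ?L" using inc[of "?\<phi> ` e"] e by (metis (mono_tags, lifting) image_eqI mem_Collect_eq)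
    qed
  qed
  have diff: "(`) \<psi> ` (A - B) = (`) \<psi> ` A - (`) \<psi> ` B"
    if "A \<subseteq> edges G" "B \<subseteq> edges G" for A B
    using inj that by (intro inj_on_image_set_diff) auto
  show ?thesis
    using assms(3) by (simp add: resign_def image_Un diff star[symmetric])
qed

lemma switching_equivalent_automorphism:
  assumes G: "simple_graph G" "automorphism G \<psi>"
    and "S \<subseteq> edges G" "switching_equivalent G S T"
  shows "switching_equivalent G ((`) \<psi> ` S) ((`) \<psi> ` T)"
proof -
  from assms(4) have "T \<subseteq> edges G \<and> switching_equivalent G ((`) \<psi> ` S) ((`) \<psi> ` T)"
    unfolding switching_equivalent_def
  proof (induction rule: rtranclp_induct)
    case base
    then show ?case using assms(3) by simp
  next
    case (step T T')
    then obtain v where v: "v \<in> verts G" "T' = resign G v T" by auto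
    then have "(`) \<psi> ` T' = resign G (\<psi> v) ((`) \<psi> ` T)"
      using resign_automorphism[OF G] step by auto
    then have "\<exists>v\<in>verts G. (`) \<psi> ` T' = resign G v ((`) \<psi> ` T)"
      using automorphism_vert[OF G(2) v(1)] by blast
    moreover have "T' \<subseteq> edges G"
      using resign_subset[of T G v] step.IH v(2) by simp
    ultimately show ?case
      using step.IH rtranclp.rtrancl_into_rtrancl[of _ "(`) \<psi> ` S" "(`) \<psi> ` T" "(`) \<psi> ` T'"]
      by simp
  qed
  then show ?thesis by simp
qed

lemma equiv_switching_iso_rel:
  assumes G: "simple_graph G" and "\<S> \<subseteq> signatures G"
  shows "equiv \<S> (switching_iso_rel G \<S>)"
proof (rule equivI)
  have sub: "S \<subseteq> edges G" if "S \<in> \<S>" for S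
    using assms(2) that by (auto simp: signatures_def)
  show "switching_iso_rel G \<S> \<subseteq> \<S> \<times> \<S>"
    by (auto simp: switching_iso_rel_def)
  show "refl_on \<S> (switching_iso_rel G \<S>)"
    using automorphism_id[of G] switching_equivalent_refl[of G]
    by (auto simp: refl_on_def switching_iso_rel_def switching_isomorphic_def intro!: exI[of _ id])
  show "sym (switching_iso_rel G \<S>)"
  proof (rule symI)
    fix S T assume "(S, T) \<in> switching_iso_rel G \<S>"
    then obtain \<psi> where ST: "S \<in> \<S>" "T \<in> \<S>" and \<psi>: "automorphism G \<psi>"
      and eq: "switching_equivalent G ((`) \<psi> ` S) T"
      by (auto simp: switching_iso_rel_def switching_isomorphic_def)
    let ?\<phi> = "inv_into (verts G) \<psi>"
    have "?\<phi> ` \<psi> ` e = e" if "e \<in> S" for e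
      using automorphism_image_inv(1)[OF G \<psi>] sub[OF ST(1)] that by blast
    then have "(`) ?\<phi> ` (`) \<psi> ` S = S"
      by (simp add: image_image cong: image_cong)
    then have "switching_equivalent G ((`) ?\<phi> ` T) S"
      using switching_equivalent_automorphism[OF G automorphism_inv[OF \<psi>] sub[OF ST(2)]
          switching_equivalent_sym[OF eq]] by simp
    then show "(T, S) \<in> switching_iso_rel G \<S>"
      using ST automorphism_inv[OF \<psi>] by (auto simp: switching_iso_rel_def switching_isomorphic_def)
  qed
  show "trans (switching_iso_rel G \<S>)"
  proof (rule transI)
    fix R S T assume "(R, S) \<in> switching_iso_rel G \<S>" "(S, T) \<in> switching_iso_rel G \<S>"
    then obtain \<psi> \<phi> where RST: "R \<in> \<S>" "S \<in> \<S>" "T \<in> \<S>"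
      and \<psi>: "automorphism G \<psi>" and \<phi>: "automorphism G \<phi>"
      and eq: "switching_equivalent G ((`) \<psi> ` R) S" "switching_equivalent G ((`) \<phi> ` S) T"
      by (auto simp: switching_iso_rel_def switching_isomorphic_def)
    have "(`) \<psi> ` R \<subseteq> edges G"
      using automorphism_edge[OF G \<psi>] sub[OF RST(1)] by auto
    then have "switching_equivalent G ((`) \<phi> ` (`) \<psi> ` R) T"
      using switching_equivalent_trans[OF switching_equivalent_automorphism[OF G \<phi> _ eq(1)] eq(2)]
      by simp
    moreover
    have "(`) (\<phi> \<circ> \<psi>) = (`) \<phi> \<circ> (`) \<psi>"
      by (rule ext) (simp only: o_apply image_comp)
    then have "(`) \<phi> ` (`) \<psi> ` R = (`) (\<phi> \<circ> \<psi>) ` R"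
      by (simp only: image_comp)
    ultimately have "switching_equivalent G ((`) (\<phi> \<circ> \<psi>) ` R) T"
      by simp
    then show "(R, T) \<in> switching_iso_rel G \<S>"
      using RST automorphism_comp[OF \<phi> \<psi>]
      by (auto simp only: switching_iso_rel_def switching_isomorphic_def mem_Collect_eq case_prod_conv)
  qed
qed

end

theory Submission
  imports Defs
begin

text \<open>The edges of a prism over an odd cycle of length \<open>m = 2 * n + 1 \<ge> 9\<close> are rim edges and spokes.
  Automorphisms preserve spokes, because these lie in two 4-cycles and rim edges only in one; hence
  every automorphism is a dihedral symmetry, possibly combined with exchanging the two rims.
  Resigning preserves the sign of every 4-cycle and of both rims. So the set of cyclic distances
  between negative 4-cycles, together with the existence of a negative rim, is invariant under
  switching isomorphism. The dihedral symmetries bring the matchings of size two to \<open>4 * n\<close> normal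
  forms, and the invariants separate these except for one pair: resigning at two adjacent vertices
  turns two neighbouring spokes into two rim edges at distance 2.\<close>

section \<open>The prism in integer coordinates modulo \<open>m\<close>\<close>

locale odd_prism =
  fixes n :: nat and m :: int
  assumes n4: "4 \<le> n" and m: "m = 2 * int n + 1"
begin

definition G :: "gp_vertex graph" where
  "G = gen_petersen (2 * n + 1) 1"

text \<open>Integer indices hide the wrap-around: rotations and reflections become affine maps, and
  equality of indices becomes divisibility by \<open>m\<close>. The Boolean selects the rim.\<close>

definition x :: "bool \<Rightarrow> int \<Rightarrow> gp_vertex" where
  "x b i = (if b then U else V) (nat (i mod m))"

definition rim :: "bool \<Rightarrow> int \<Rightarrow> gp_vertex set" where
  "rim b i = {x b i, x b (i + 1)}"

definition spoke :: "int \<Rightarrow> gp_vertex set" where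
  "spoke i = {x True i, x False i}"

lemma dvd_small: "m dvd z \<longleftrightarrow> z = 0" if "\<bar>z\<bar> < m"
  using that zdvd_imp_le[of m "\<bar>z\<bar>"] by auto

lemma dvd_medium: "m dvd z \<longleftrightarrow> z = 0 \<or> z = m \<or> z = - m" if "- (2 * m) < z" "z < 2 * m"
proof
  assume "m dvd z"
  then obtain k where k: "z = m * k" ..
  have "0 < m" using m by simp
  moreover have "m * (-2) < m * k" "m * k < m * 2" using that by (simp_all add: k mult.commute)
  ultimately have "-2 < k" "k < 2" by (metis mult_less_cancel_left_pos)+
  then have "k = 0 \<or> k = 1 \<or> k = -1" by linarith
  with k show "z = 0 \<or> z = m \<or> z = - m" by auto
qed auto

text \<open>Rules out that two index conditions hold at once: the difference would be a nonzero
  multiple of \<open>m\<close> that is too small.\<close>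

lemma dvd_exclusive: "\<not> (m dvd y \<and> m dvd z)" if "0 < \<bar>y - z\<bar>" "\<bar>y - z\<bar> < m"
  using that dvd_small[of "y - z"] by auto

lemma x_eq_iff: "x b i = x c j \<longleftrightarrow> b = c \<and> m dvd i - j"
proof -
  have "nat (i mod m) = nat (j mod m) \<longleftrightarrow> m dvd i - j"
    using m by (simp add: mod_eq_dvd_iff[symmetric] nat_eq_iff)
  then show ?thesis by (auto simp: x_def)
qed

lemma x_nat: "k < 2 * n + 1 \<Longrightarrow> x b (int k) = (if b then U else V) k"
  unfolding x_def using m by (subst mod_pos_pos_trivial) auto

lemma x_cong: "m dvd i - j \<Longrightarrow> x b i = x b j"
  by (simp add: x_eq_iff)

lemma x_mod: "x b (i mod m) = x b i"
  by (simp add: x_def)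

text \<open>Brings an integer index back to the natural-number indices of
  \<open>gen_petersen\<close>.\<close>

lemma obtain_residue:
  obtains k where "k < 2 * n + 1" "\<And>b. x b i = x b (int k)" "m dvd i - int k"
proof
  show "nat (i mod m) < 2 * n + 1" using m pos_mod_bound[of m i] by linarith
  have "int (nat (i mod m)) = i mod m" using m by simp
  then show "x b i = x b (int (nat (i mod m)))" for b by (simp add: x_mod)
  then show "m dvd i - int (nat (i mod m))" using x_eq_iff by blast
qed

lemma verts_iff: "y \<in> verts G \<longleftrightarrow> (\<exists>b i. y = x b i)"
proof
  assume "y \<in> verts G"
  then obtain k where "k < 2 * n + 1" "y = U k \<or> y = V k"
    by (auto simp: G_def gen_petersen_def)
  then have "y = x True (int k) \<or> y = x False (int k)" by (auto simp: x_nat)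
  then show "\<exists>b i. y = x b i" by blast
next
  assume "\<exists>b i. y = x b i"
  then obtain b i where y: "y = x b i" by blast
  obtain k where "k < 2 * n + 1" "x b i = x b (int k)" by (rule obtain_residue[of i]) blast
  then show "y \<in> verts G" using y by (auto simp: G_def gen_petersen_def x_nat)
qed

lemma x_verts [simp]: "x b i \<in> verts G"
  using verts_iff by blast

lemma edges_iff: "e \<in> edges G \<longleftrightarrow> (\<exists>b i. e = rim b i) \<or> (\<exists>i. e = spoke i)"
proof -
  have step: "(if b then U else V) ((k + 1) mod (2 * n + 1)) = x b (int k + 1)" for b k
  proof -
    have "int ((k + 1) mod (2 * n + 1)) = (int k + 1) mod m"
      unfolding m zmod_int by (simp add: add.commute)
    then show ?thesis unfolding x_def by (metis nat_int)
  qed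
  have rim: "{U k, U ((k + 1) mod (2 * n + 1))} = rim True (int k)"
    "{V k, V ((k + 1) mod (2 * n + 1))} = rim False (int k)"
    and spoke: "{U k, V k} = spoke (int k)" if "k < 2 * n + 1" for k
    using step[of True k] step[of False k] that x_nat[of k]
    by (simp_all add: rim_def spoke_def)
  show ?thesis
  proof
    assume "e \<in> edges G"
    then obtain k where "k < 2 * n + 1"
      "e = {U k, U ((k + 1) mod (2 * n + 1))} \<or> e = {V k, V ((k + 1) mod (2 * n + 1))} \<or> e = {U k, V k}"
      unfolding G_def gen_petersen_def by auto
    then show "(\<exists>b i. e = rim b i) \<or> (\<exists>i. e = spoke i)"
      using rim spoke by metis
  next
    have *: "rim b i \<in> edges G \<and> spoke i \<in> edges G" for b i
    proof -
      obtain k where k: "k < 2 * n + 1" and xk: "\<And>b. x b i = x b (int k)" and "m dvd i - int k"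
        by (rule obtain_residue[of i]) blast
      then have "x b (i + 1) = x b (int k + 1)" by (simp add: x_eq_iff)
      then have "rim b i = rim b (int k)" "spoke i = spoke (int k)"
        using xk by (simp_all add: rim_def spoke_def)
      moreover have "{rim True (int k), rim False (int k), spoke (int k)} \<subseteq> edges G"
        using k unfolding G_def gen_petersen_def rim[OF k, symmetric] spoke[OF k, symmetric]
        by auto
      ultimately show ?thesis by (cases b) auto
    qed
    assume "(\<exists>b i. e = rim b i) \<or> (\<exists>i. e = spoke i)"
    then show "e \<in> edges G" using * by auto
  qed
qed

lemma rim_edge [simp]: "rim b i \<in> edges G" and spoke_edge [simp]: "spoke i \<in> edges G"
  using edges_iff by blast+

lemma simple: "simple_graph G"
  unfolding G_def using n4 by (intro simple_graph_gen_petersen) auto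

section \<open>Incidence, equality and adjacency as divisibility conditions\<close>

lemma in_rim_iff: "x b i \<in> rim c j \<longleftrightarrow> b = c \<and> (m dvd i - j \<or> m dvd i - j - 1)"
  by (auto simp: rim_def x_eq_iff algebra_simps)

lemma in_spoke_iff: "x b i \<in> spoke j \<longleftrightarrow> m dvd i - j"
  by (cases b) (auto simp: spoke_def x_eq_iff)

lemma rim_eq_iff [simp]: "rim b i = rim c j \<longleftrightarrow> b = c \<and> m dvd i - j"
proof
  assume eq: "rim b i = rim c j"
  have "x b i \<in> rim c j" "x b (i + 1) \<in> rim c j"
    using eq by (auto simp: rim_def)
  then have "b = c" "m dvd i - j \<or> m dvd i - j - 1" "m dvd i - j + 1 \<or> m dvd i - j"
    by (auto simp: in_rim_iff algebra_simps)
  \<comment> \<open>If the endpoints were swapped instead, \<open>m\<close> would divide both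
    \<open>i - j + 1\<close> and \<open>i - j - 1\<close>, which differ by 2.\<close>
  then show "b = c \<and> m dvd i - j"
    using dvd_exclusive[of "i - j + 1" "i - j - 1"] m n4 by auto
next
  assume "b = c \<and> m dvd i - j"
  then have "b = c" "x b i = x b j" "x b (i + 1) = x b (j + 1)"
    by (auto intro: x_cong)
  then show "rim b i = rim c j" by (simp add: rim_def)
qed

lemma spoke_eq_iff [simp]: "spoke i = spoke j \<longleftrightarrow> m dvd i - j"
proof
  assume "spoke i = spoke j"
  then have "x True i \<in> spoke j" by (auto simp: spoke_def)
  then show "m dvd i - j" by (simp add: in_spoke_iff)
next
  assume "m dvd i - j"
  then show "spoke i = spoke j" unfolding spoke_def by (simp add: x_cong[of i j])
qed

lemma rim_ne_spoke [simp]: "rim b i \<noteq> spoke j" "spoke j \<noteq> rim b i"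
proof -
  have "x (\<not> b) j \<in> spoke j" "x (\<not> b) j \<notin> rim b i"
    by (simp_all add: in_spoke_iff in_rim_iff)
  then show "rim b i \<noteq> spoke j" "spoke j \<noteq> rim b i" by auto
qed

lemma adj_iff: "{x b i, x c j} \<in> edges G \<longleftrightarrow>
  (b = c \<and> (m dvd j - i - 1 \<or> m dvd j - i + 1)) \<or> (b \<noteq> c \<and> m dvd j - i)"
proof
  assume "{x b i, x c j} \<in> edges G"
  then consider d k where "{x b i, x c j} = rim d k" | k where "{x b i, x c j} = spoke k"
    by (metis edges_iff)
  then show "(b = c \<and> (m dvd j - i - 1 \<or> m dvd j - i + 1)) \<or> (b \<noteq> c \<and> m dvd j - i)"
  proof cases
    case 1
    then have "(x b i = x d k \<and> x c j = x d (k + 1)) \<or> (x c j = x d k \<and> x b i = x d (k + 1))"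
      by (simp add: rim_def doubleton_eq_iff) metis
    then have "b = c \<and> (m dvd (j - (k + 1)) - (i - k) \<or> m dvd (j - k) - (i - (k + 1)))"
      unfolding x_eq_iff by (metis dvd_diff)
    then show ?thesis by (simp add: algebra_simps)
  next
    case 2
    then have "(x b i = x True k \<and> x c j = x False k) \<or> (x c j = x True k \<and> x b i = x False k)"
      by (simp add: spoke_def doubleton_eq_iff) metis
    then have "b \<noteq> c \<and> m dvd (j - k) - (i - k)"
      unfolding x_eq_iff by (metis dvd_diff)
    then show ?thesis by simp
  qed
next
  assume "(b = c \<and> (m dvd j - i - 1 \<or> m dvd j - i + 1)) \<or> (b \<noteq> c \<and> m dvd j - i)"
  then consider "b = c" "m dvd j - i - 1" | "b = c" "m dvd j - i + 1" | "b \<noteq> c" "m dvd j - i"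
    by blast
  then show "{x b i, x c j} \<in> edges G"
  proof cases
    case 1
    then have "x c j = x b (i + 1)" by (simp add: x_eq_iff algebra_simps)
    then show ?thesis using rim_edge[of b i] by (simp add: rim_def)
  next
    case 2
    then have "x b i = x c (j + 1)"
      using dvd_diff_commute[of m i "j + 1"] by (simp add: x_eq_iff algebra_simps)
    then show ?thesis using rim_edge[of c j] by (simp add: rim_def insert_commute)
  next
    case 3
    then have "x c j = x c i" by (simp add: x_eq_iff)
    with 3 have "{x b i, x c j} = spoke i" by (cases b) (auto simp: spoke_def)
    then show ?thesis by simp
  qed
qed

subsection \<open>Automorphisms\<close>

text \<open>For \<open>s = 1\<close> these are the rotations and for \<open>s = -1\<close> the
  reflections, combined with the exchange of the rims when \<open>c\<close> is true.\<close>

fun move :: "bool \<Rightarrow> int \<Rightarrow> int \<Rightarrow> gp_vertex \<Rightarrow> gp_vertex" where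
  "move c a s (U k) = x (\<not> c) (a + s * int k)"
| "move c a s (V k) = x c (a + s * int k)"

text \<open>Passing to the residue of \<open>i\<close> changes \<open>a + s * i\<close> by a
  multiple of \<open>m\<close>, so the formula holds for every integer index.\<close>

lemma move_x [simp]: "move c a s (x b i) = x (b \<noteq> c) (a + s * i)"
proof -
  obtain k where k: "k < 2 * n + 1" "x b i = x b (int k)" "m dvd i - int k"
    by (rule obtain_residue[of i]) blast
  then have "m dvd (a + s * int k) - (a + s * i)"
    using dvd_mult[of m "int k - i" s] dvd_diff_commute[of m i] by (simp add: algebra_simps)
  then have "x (b \<noteq> c) (a + s * int k) = x (b \<noteq> c) (a + s * i)"
    by (rule x_cong)
  moreover have "move c a s (x b i) = x (b \<noteq> c) (a + s * int k)"
    using k x_nat[of k b] by (cases b; cases c) auto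
  ultimately show ?thesis by simp
qed

lemma move_automorphism:
  assumes "s = 1 \<or> s = -1"
  shows "automorphism G (move c a s)"
  unfolding automorphism_def
proof (intro conjI ballI)
  have dvd: "m dvd (a + s * i) - (a + s * j) \<longleftrightarrow> m dvd i - j" for i j
    using assms dvd_diff_commute[of m i j] by auto
  have inj: "inj_on (move c a s) (verts G)"
  proof (rule inj_onI)
    fix y z assume "y \<in> verts G" "z \<in> verts G" and eq: "move c a s y = move c a s z"
    then obtain b i b' i' where "y = x b i" "z = x b' i'" unfolding verts_iff by blast
    moreover from this have "x (b \<noteq> c) (a + s * i) = x (b' \<noteq> c) (a + s * i')"
      using eq by simp
    then have "b = b'" "m dvd i - i'"
      unfolding x_eq_iff dvd by auto
    ultimately show "y = z" by (simp add: x_eq_iff)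
  qed
  have sub: "move c a s ` verts G \<subseteq> verts G"
    using verts_iff by fastforce
  have "finite (verts G)" by (simp add: G_def gen_petersen_def)
  then show "bij_betw (move c a s) (verts G) (verts G)"
    using inj sub by (simp add: bij_betw_def endo_inj_surj)
  fix y z assume "y \<in> verts G" "z \<in> verts G"
  then obtain b i b' i' where yz: "y = x b i" "z = x b' i'" unfolding verts_iff by blast
  \<comment> \<open>A rotation keeps the forward and backward rim neighbours apart; a reflection
    swaps them.\<close>
  have "m dvd (a + s * i') - (a + s * i) - 1 \<longleftrightarrow> m dvd i' - i - s"
    "m dvd (a + s * i') - (a + s * i) + 1 \<longleftrightarrow> m dvd i' - i + s"
    using assms dvd_minus_iff[of m "i' - i + 1"] dvd_minus_iff[of m "i' - i - 1"]
    by (auto simp: algebra_simps)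
  then show "{y, z} \<in> edges G \<longleftrightarrow> {move c a s y, move c a s z} \<in> edges G"
    unfolding yz move_x adj_iff dvd using assms by (elim disjE; cases c) (simp_all add: disj_commute)
qed

text \<open>Spokes are the edges \<open>{y, z}\<close> that lie in a 4-cycle together with every other edge at \<open>y\<close>,
  which makes them recognisable to automorphisms.\<close>

definition rung :: "gp_vertex \<Rightarrow> gp_vertex \<Rightarrow> bool" where
  "rung y z \<longleftrightarrow> (\<forall>w\<in>verts G. {y, w} \<in> edges G \<and> w \<noteq> z \<longrightarrow>
     (\<exists>w'\<in>verts G. w' \<noteq> y \<and> {w, w'} \<in> edges G \<and> {w', z} \<in> edges G))"

lemma rung_spoke: "rung (x b i) (x (\<not> b) i)"
  unfolding rung_def
proof (intro ballI impI, elim conjE)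
  fix w assume "w \<in> verts G" and adj: "{x b i, w} \<in> edges G" and ne: "w \<noteq> x (\<not> b) i"
  then obtain c j where w: "w = x c j" unfolding verts_iff by blast
  have c: "c = b" "m dvd j - i - 1 \<or> m dvd j - i + 1"
    using adj ne by (auto simp: w adj_iff x_eq_iff)
  moreover from this have "m dvd i - j - 1 \<or> m dvd i - j + 1"
    using dvd_minus_iff[of m "j - i - 1"] dvd_minus_iff[of m "j - i + 1"]
    by (auto simp: algebra_simps)
  \<comment> \<open>The 4-cycle closes through the other end of the spoke at
    \<open>w\<close>.\<close>
  ultimately have "x (\<not> b) j \<noteq> x b i \<and> {w, x (\<not> b) j} \<in> edges G \<and> {x (\<not> b) j, x (\<not> b) i} \<in> edges G"
    by (simp add: w adj_iff x_eq_iff)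
  then show "\<exists>w'\<in>verts G. w' \<noteq> x b i \<and> {w, w'} \<in> edges G \<and> {w', x (\<not> b) i} \<in> edges G"
    using x_verts by blast
qed

text \<open>Let the edge run from index \<open>i\<close> to \<open>i + s\<close>. The edge from
  \<open>i\<close> to \<open>i - s\<close> violates the condition: as \<open>m\<close> is at least
  9, the only path of length two from \<open>i - s\<close> to \<open>i + s\<close> passes through
  \<open>x b i\<close>.\<close>

lemma not_rung_rim:
  assumes "{x b i, x b j} \<in> edges G"
  shows "\<not> rung (x b i) (x b j)"
proof
  assume rung: "rung (x b i) (x b j)"
  have "m dvd j - i - 1 \<or> m dvd j - i + 1" using assms by (simp add: adj_iff)
  then obtain s :: int where s: "s = 1 \<or> s = -1" and j: "m dvd j - i - s"
    by (metis diff_minus_eq_add)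
  have "{x b i, x b (i - s)} \<in> edges G" using s by (auto simp: adj_iff)
  moreover have "x b (i - s) \<noteq> x b j"
  proof
    assume "x b (i - s) = x b j"
    then have "m dvd (i - s - j) + (j - i - s)" using j by (intro dvd_add) (simp_all add: x_eq_iff)
    then show False using s m n4 dvd_small[of "-2"] dvd_small[of 2] by auto
  qed
  ultimately obtain w' where "w' \<in> verts G" "w' \<noteq> x b i"
    "{x b (i - s), w'} \<in> edges G" "{w', x b j} \<in> edges G"
    using rung x_verts unfolding rung_def by blast
  then obtain c k where ne: "x c k \<noteq> x b i"
    and adj: "{x b (i - s), x c k} \<in> edges G" "{x c k, x b j} \<in> edges G"
    unfolding verts_iff by blast
  show False
  proof (cases "c = b")
    case True
    \<comment> \<open>Staying on the rim, \<open>w'\<close> must have index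
      \<open>i - 2 * s\<close>, at distance 3 from \<open>i + s\<close>, but adjacency requires
      distance 1.\<close>
    have "m dvd k - i + 2 * s"
      using adj(1) ne s True by (auto simp: adj_iff x_eq_iff algebra_simps)
    moreover have "m dvd j - k - 1 \<or> m dvd j - k + 1"
      using adj(2) True by (simp add: adj_iff)
    then obtain t :: int where t: "t = 1 \<or> t = -1" and "m dvd j - k - t"
      by (metis diff_minus_eq_add)
    ultimately have "m dvd (k - i + 2 * s) - (j - i - s) + (j - k - t)"
      using j by (blast intro: dvd_add dvd_diff)
    then have "m dvd 3 * s - t" by (simp add: algebra_simps)
    then show False using s t m n4 dvd_small[of "3 * s - t"] by auto
  next
    case False
    \<comment> \<open>On the other rim both edges at \<open>w'\<close> are spokes, which forces
      \<open>i - s\<close> and \<open>i + s\<close> to agree modulo \<open>m\<close>.\<close>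
    then have "m dvd (k - (i - s)) + (j - k) - (j - i - s)"
      using adj j by (intro dvd_add[OF _ _] dvd_diff[OF _ j]) (auto simp: adj_iff)
    then show False using s m n4 dvd_small[of "2 * s"] by auto
  qed
qed

text \<open>\<open>rung\<close> speaks of adjacency alone, so it suffices to pull \<open>w\<close>
  back along the bijection.\<close>

lemma rung_automorphism:
  assumes "automorphism G \<psi>" "rung y z" "y \<in> verts G" "z \<in> verts G"
  shows "rung (\<psi> y) (\<psi> z)"
  unfolding rung_def
proof (intro ballI impI, elim conjE)
  fix w assume w: "w \<in> verts G" "{\<psi> y, w} \<in> edges G" "w \<noteq> \<psi> z"
  have bij: "bij_betw \<psi> (verts G) (verts G)" by (rule automorphism_bij[OF assms(1)])
  with w obtain v where v: "v \<in> verts G" "w = \<psi> v" by (metis bij_betw_imp_surj_on imageE)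
  then have "{y, v} \<in> edges G" "v \<noteq> z"
    using w assms automorphism_pair[OF assms(1)] by auto
  then obtain v' where v': "v' \<in> verts G" "v' \<noteq> y" "{v, v'} \<in> edges G" "{v', z} \<in> edges G"
    using assms v unfolding rung_def by blast
  then have "\<psi> v' \<noteq> \<psi> y"
    using bij assms by (meson bij_betw_imp_inj_on inj_onD)
  moreover have "{w, \<psi> v'} \<in> edges G" "{\<psi> v', \<psi> z} \<in> edges G" "\<psi> v' \<in> verts G"
    using v v' assms automorphism_pair[OF assms(1)] automorphism_vert by auto
  ultimately show "\<exists>w'\<in>verts G. w' \<noteq> \<psi> y \<and> {w, w'} \<in> edges G \<and> {w', \<psi> z} \<in> edges G"
    by blast
qed

text \<open>Spokes go to spokes, hence rims to rims. The images of \<open>x True 0\<close> and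
  \<open>x True 1\<close> fix \<open>a\<close> and \<open>s\<close>; by injectivity the image of a
  walk along the rim cannot turn back, and the spokes carry the formula to the other rim.\<close>

lemma automorphism_cases:
  assumes \<psi>: "automorphism G \<psi>"
  obtains c a s where "s = 1 \<or> s = -1" "\<And>b i. \<psi> (x b i) = x (b \<noteq> c) (a + s * i)"
proof -
  have inj: "y = z" if "\<psi> y = \<psi> z" "y \<in> verts G" "z \<in> verts G" for y z
    using that automorphism_bij[OF \<psi>] by (meson bij_betw_imp_inj_on inj_onD)
  have image: "\<exists>c j. \<psi> (x b i) = x c j" for b i
    using automorphism_vert[OF \<psi> x_verts] verts_iff by blast
  have adj: "{\<psi> (x b i), \<psi> (x c j)} \<in> edges G" if "{x b i, x c j} \<in> edges G" for b c i j
    using that automorphism_pair[OF \<psi> x_verts x_verts] by blast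
  have partner: "\<psi> (x (\<not> b) i) = x (\<not> e) j" if e: "\<psi> (x b i) = x e j" for b e i j
  proof -
    obtain e' j' where e': "\<psi> (x (\<not> b) i) = x e' j'" using image by blast
    have edge: "{x e j, x e' j'} \<in> edges G"
      using adj[of b i "\<not> b" i] e e' by (simp add: adj_iff)
    have "rung (x e j) (x e' j')"
      using rung_automorphism[OF \<psi> rung_spoke x_verts x_verts, of b i] e e' by simp
    then have "e \<noteq> e'" using not_rung_rim edge by blast
    then have "e' = (\<not> e)" "m dvd j' - j" using edge by (auto simp: adj_iff)
    then show ?thesis using e' x_cong by simp
  qed
  have neighbour: "\<exists>t. (t = 1 \<or> t = -1) \<and> \<psi> (x b (i + 1)) = x e (j + t)"
    if e: "\<psi> (x b i) = x e j" for b e i j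
  proof -
    obtain e' j' where e': "\<psi> (x b (i + 1)) = x e' j'" using image by blast
    have edge: "{x e j, x e' j'} \<in> edges G"
      using adj[of b i b "i + 1"] e e' by (simp add: adj_iff)
    \<comment> \<open>Changing rims would hit the image of the spoke partner of
      \<open>x b i\<close>, against injectivity.\<close>
    have "e = e'"
    proof (rule ccontr)
      assume "e \<noteq> e'"
      then have "x e' j' = x (\<not> e) j" using edge by (auto simp: adj_iff x_eq_iff)
      then have "\<psi> (x b (i + 1)) = \<psi> (x (\<not> b) i)" using e' partner[OF e] by simp
      then have "x b (i + 1) = x (\<not> b) i" by (rule inj) simp_all
      then show False by (simp add: x_eq_iff)
    qed
    then have "m dvd j' - (j + 1) \<or> m dvd j' - (j + -1)"
      using edge by (simp add: adj_iff algebra_simps)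
    then have "x e j' = x e (j + 1) \<or> x e j' = x e (j + -1)"
      using x_cong[of j' _ e] by blast
    then show ?thesis using e' \<open>e = e'\<close> by auto
  qed
  obtain d a where d: "\<psi> (x True 0) = x d a" using image by blast
  obtain s where s: "s = 1 \<or> s = -1" "\<psi> (x True 1) = x d (a + s)"
    using neighbour[OF d] by auto
  \<comment> \<open>Two consecutive vertices are carried along, because the direction of the next
    step is found by excluding a return to the earlier one.\<close>
  have "\<psi> (x True (int k)) = x d (a + s * int k) \<and>
    \<psi> (x True (int k + 1)) = x d (a + s * (int k + 1))" for k
  proof (induction k)
    case 0
    show ?case using d s by simp
  next
    case (Suc k)
    obtain t where t: "t = 1 \<or> t = -1"
      "\<psi> (x True (int k + 1 + 1)) = x d (a + s * (int k + 1) + t)"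
      using Suc neighbour by blast
    have "t = s"
    proof (rule ccontr)
      assume "t \<noteq> s"
      then have "t = - s" using s t by auto
      then have "\<psi> (x True (int k + 1 + 1)) = \<psi> (x True (int k))"
        using t Suc by (simp add: algebra_simps)
      then have "x True (int k + 1 + 1) = x True (int k)" by (rule inj) simp_all
      then show False using m n4 dvd_small[of 2] unfolding x_eq_iff by simp
    qed
    then show ?case using Suc t by (simp add: algebra_simps)
  qed
  then have nat: "\<psi> (x True (int k)) = x d (a + s * int k)" for k by blast
  have True: "\<psi> (x True i) = x d (a + s * i)" for i
  proof -
    obtain k where k: "x True i = x True (int k)" "m dvd i - int k"
      by (rule obtain_residue[of i]) blast
    then have "m dvd (a + s * i) - (a + s * int k)"
      using dvd_mult[of m "i - int k" s] by (simp add: algebra_simps)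
    then have "x d (a + s * i) = x d (a + s * int k)" by (rule x_cong)
    then show ?thesis using nat[of k] k by simp
  qed
  \<comment> \<open>The rim exchange is \<open>\<not> d\<close>, since the rim \<open>True\<close>
    is sent to the rim \<open>d\<close>.\<close>
  have "\<psi> (x b i) = x (b \<noteq> (\<not> d)) (a + s * i)" for b i
    using True[of i] partner[OF True[of i]] by (cases b) auto
  with s(1) show ?thesis by (rule that)
qed

text \<open>A reflection turns the endpoints \<open>i\<close> and \<open>i + 1\<close> into
  \<open>a - i\<close> and \<open>a - i - 1\<close>; the latter is now the starting index, whence
  the shift by one.\<close>

lemma move_rim:
  "move c a 1 ` rim b i = rim (b \<noteq> c) (a + i)"
  "move c a (-1) ` rim b i = rim (b \<noteq> c) (a - i - 1)"
  by (auto simp: rim_def algebra_simps)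

lemma move_spoke: "move c a s ` spoke i = spoke (a + s * i)"
  by (cases c) (auto simp: spoke_def)

subsection \<open>Invariants of switching isomorphism\<close>

text \<open>The sign of the 4-cycle between \<open>spoke i\<close> and \<open>spoke (i + 1)\<close>:
  true when its number of negative edges is odd.\<close>

definition neg_face :: "gp_vertex set set \<Rightarrow> int \<Rightarrow> bool" where
  "neg_face S i \<longleftrightarrow>
     ((rim True i \<in> S) \<noteq> (rim False i \<in> S)) \<noteq> ((spoke i \<in> S) \<noteq> (spoke (i + 1) \<in> S))"

text \<open>Symmetric under negation, as the two faces may trade roles, and therefore blind to
  reflections. It contains 0 as soon as some face is negative.\<close>

definition gaps :: "gp_vertex set set \<Rightarrow> int set" where
  "gaps S = {t. \<exists>i. neg_face S i \<and> neg_face S (i + t)}"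

text \<open>The sign of the cycle of length \<open>m\<close> formed by one rim; true means
  negative.\<close>

definition rim_odd :: "gp_vertex set set \<Rightarrow> bool \<Rightarrow> bool" where
  "rim_odd S b \<longleftrightarrow> odd (card (S \<inter> range (rim b)))"

lemma finite_rims: "finite (range (rim b))"
proof -
  have "range (rim b) \<subseteq> Pow (verts G)" by (auto simp: rim_def)
  moreover have "finite (verts G)" by (simp add: G_def gen_petersen_def)
  ultimately show ?thesis by (meson finite_Pow_iff finite_subset)
qed

lemma odd_card_sym_diff:
  assumes "finite A" "finite B"
  shows "odd (card (sym_diff A B)) \<longleftrightarrow> odd (card A) \<noteq> odd (card B)"
proof -
  have "card (sym_diff A B) = card (A - B) + card (B - A)"
    using assms by (intro card_Un_disjoint) auto
  moreover have "card A = card (A - B) + card (A \<inter> B)" "card B = card (B - A) + card (A \<inter> B)"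
    using assms by (metis Int_commute card_Diff_subset_Int card_mono finite_Int Int_lower1 le_add_diff_inverse2)+
  ultimately show ?thesis by auto
qed

lemma in_resign_iff: "e \<in> edges G \<Longrightarrow> e \<in> resign G v S \<longleftrightarrow> (e \<in> S) \<noteq> (v \<in> e)"
  by (auto simp: resign_def)

text \<open>A vertex meets none or exactly two edges of a 4-cycle, namely one rim edge and one
  spoke, so the two toggles cancel.\<close>

lemma neg_face_resign: "neg_face (resign G (x b j) S) i \<longleftrightarrow> neg_face S i"
proof -
  have "\<not> (m dvd j - i \<and> m dvd j - i - 1)"
    using m n4 by (intro dvd_exclusive) auto
  then show ?thesis
    by (cases b) (auto simp: neg_face_def in_resign_iff in_rim_iff in_spoke_iff algebra_simps)
qed

text \<open>A vertex lies on two edges of its own rim and on none of the other, so an even number of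
  edges is toggled.\<close>

lemma rim_odd_resign: "rim_odd (resign G (x c j) S) b \<longleftrightarrow> rim_odd S b"
proof -
  let ?B = "{e \<in> range (rim b). x c j \<in> e}"
  have "m dvd j - i - 1 \<longleftrightarrow> m dvd i - (j - 1)" for i
    using dvd_diff_commute[of m "j - 1" i] by (simp add: algebra_simps)
  then have "x c j \<in> rim b i \<longleftrightarrow> b = c \<and> (rim b i = rim b j \<or> rim b i = rim b (j - 1))" for i
    using dvd_diff_commute[of m j] by (auto simp: in_rim_iff)
  then have B: "?B = (if b = c then {rim b j, rim b (j - 1)} else {})"
    by (auto simp del: rim_eq_iff)
  have "rim b j \<noteq> rim b (j - 1)"
    using m n4 dvd_small[of 1] unfolding rim_eq_iff by simp
  then have "even (card ?B)" unfolding B by simp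
  moreover have "resign G (x c j) S \<inter> range (rim b) = sym_diff (S \<inter> range (rim b)) ?B"
    by (auto simp: resign_def)
  ultimately show ?thesis
    using odd_card_sym_diff[of "S \<inter> range (rim b)" ?B] finite_rims by (simp add: rim_odd_def)
qed

lemma switching_equivalent_invariants:
  assumes "switching_equivalent G S T"
  shows "neg_face T = neg_face S \<and> rim_odd T = rim_odd S"
  using assms unfolding switching_equivalent_def
proof (induction rule: rtranclp_induct)
  case (step T T')
  then obtain b i where "T' = resign G (x b i) T" by (metis verts_iff)
  with step.IH show ?case by (auto simp: neg_face_resign rim_odd_resign fun_eq_iff)
qed simp

lemma automorphism_invariants:
  assumes \<psi>: "automorphism G \<psi>" and S: "S \<subseteq> edges G"
  shows "gaps ((`) \<psi> ` S) = gaps S \<and> (\<exists>c. \<forall>b. rim_odd ((`) \<psi> ` S) (b \<noteq> c) = rim_odd S b)"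
proof -
  obtain c a s where s: "s = 1 \<or> s = -1" and \<psi>_x: "\<And>b i. \<psi> (x b i) = x (b \<noteq> c) (a + s * i)"
    by (rule automorphism_cases[OF \<psi>]) blast
  let ?S = "(`) \<psi> ` S"
  \<comment> \<open>Only the values of \<open>\<psi>\<close> on vertices are known, so it is
    replaced by \<open>move\<close> edge by edge.\<close>
  have \<psi>_move: "\<psi> ` e = move c a s ` e" if "e \<in> edges G" for e
  proof -
    have "\<psi> y = move c a s y" if "y \<in> e" for y
      using that \<open>e \<in> edges G\<close> unfolding edges_iff by (auto simp: rim_def spoke_def \<psi>_x)
    then show ?thesis by (rule image_cong[OF refl])
  qed
  have inj: "inj_on ((`) \<psi>) (edges G)"
    using automorphism_image_inv(1)[OF simple \<psi>] by (metis inj_on_inverseI)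
  have mem: "move c a s ` e \<in> ?S \<longleftrightarrow> e \<in> S" if "e \<in> edges G" for e
    using inj_on_image_mem_iff[OF inj that S] \<psi>_move[OF that] by simp
  \<comment> \<open>The induced permutation of the faces, with the same shift for reflections as in
    \<open>move_rim\<close>.\<close>
  define h where "h i = (if s = 1 then a + i else a - i - 1)" for i
  have rim: "move c a s ` rim b i = rim (b \<noteq> c) (h i)" for b i
    using s by (elim disjE) (simp_all add: h_def move_rim)
  have h_surj: "\<exists>k. i = h k" for i
    by (rule exI[of _ "if s = 1 then i - a else a - i - 1"]) (simp add: h_def)
  have neg_face: "neg_face ?S (h i) \<longleftrightarrow> neg_face S i" for i
  proof -
    have "rim (b \<noteq> c) (h i) \<in> ?S \<longleftrightarrow> rim b i \<in> S" for b
      using mem[of "rim b i"] rim by simp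
    from this[of True] this[of False]
    have "(rim True (h i) \<in> ?S) \<noteq> (rim False (h i) \<in> ?S) \<longleftrightarrow> (rim True i \<in> S) \<noteq> (rim False i \<in> S)"
      by (cases c) auto
    moreover have "spoke (a + s * k) \<in> ?S \<longleftrightarrow> spoke k \<in> S" for k
      using mem[of "spoke k"] move_spoke by simp
    from this[of i] this[of "i + 1"]
    \<comment> \<open>Under a reflection the two spokes of the face trade places, which the
      exclusive or does not notice.\<close>
    have "(spoke (h i) \<in> ?S) \<noteq> (spoke (h i + 1) \<in> ?S) \<longleftrightarrow> (spoke i \<in> S) \<noteq> (spoke (i + 1) \<in> S)"
      using s by (auto simp: h_def algebra_simps)
    ultimately show ?thesis unfolding neg_face_def by blast
  qed
  have "t \<in> gaps ?S \<longleftrightarrow> t \<in> gaps S" for t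
  proof
    assume "t \<in> gaps ?S"
    then obtain i where i: "neg_face ?S i" "neg_face ?S (i + t)" by (auto simp: gaps_def)
    obtain k k' where k: "i = h k" "i + t = h k'" using h_surj by metis
    then have "neg_face S k" "neg_face S k'" using i neg_face by metis+
    moreover have "k' = k + t \<or> k = k' + t" using k s by (auto simp: h_def split: if_splits)
    ultimately show "t \<in> gaps S" by (auto simp: gaps_def)
  next
    assume "t \<in> gaps S"
    then obtain i where "neg_face S i" "neg_face S (i + t)" by (auto simp: gaps_def)
    then have "neg_face ?S (h i)" "neg_face ?S (h (i + t))" using neg_face by simp_all
    moreover have "h (i + t) = h i + t \<or> h i = h (i + t) + t" by (auto simp: h_def)
    ultimately show "t \<in> gaps ?S" unfolding gaps_def by (metis (mono_tags, lifting) mem_Collect_eq)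
  qed
  moreover have "rim_odd ?S (b \<noteq> c) = rim_odd S b" for b
  proof -
    have "?S \<inter> range (rim (b \<noteq> c)) = (`) \<psi> ` (S \<inter> range (rim b))"
    proof (intro subset_antisym subsetI)
      fix e assume e: "e \<in> ?S \<inter> range (rim (b \<noteq> c))"
      then obtain k where k: "e = rim (b \<noteq> c) (h k)" using h_surj by (metis Int_iff rangeE)
      then have "rim b k \<in> S" using e mem[of "rim b k"] rim by simp
      moreover have "e = \<psi> ` rim b k" using \<psi>_move rim k by simp
      ultimately show "e \<in> (`) \<psi> ` (S \<inter> range (rim b))" by blast
    next
      fix e assume "e \<in> (`) \<psi> ` (S \<inter> range (rim b))"
      then obtain k where "e = \<psi> ` rim b k" "rim b k \<in> S" by auto
      moreover from this have "e = rim (b \<noteq> c) (h k)" using \<psi>_move rim by simp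
      ultimately show "e \<in> ?S \<inter> range (rim (b \<noteq> c))" by blast
    qed
    moreover have "inj_on ((`) \<psi>) (S \<inter> range (rim b))"
      by (rule inj_on_subset[OF inj]) (use S in auto)
    ultimately show ?thesis by (simp add: rim_odd_def card_image)
  qed
  ultimately show ?thesis by blast
qed

text \<open>An automorphism may exchange the two rim signs, so only the existence of a negative rim
  is kept.\<close>

lemma switching_isomorphic_invariants:
  assumes "switching_isomorphic G S T" "S \<subseteq> edges G"
  shows "gaps T = gaps S" "(\<exists>b. rim_odd T b) \<longleftrightarrow> (\<exists>b. rim_odd S b)"
proof -
  obtain \<psi> where \<psi>: "automorphism G \<psi>" and eq: "switching_equivalent G ((`) \<psi> ` S) T"
    using assms unfolding switching_isomorphic_def by blast
  have T: "neg_face T = neg_face ((`) \<psi> ` S)" "rim_odd T = rim_odd ((`) \<psi> ` S)"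
    using switching_equivalent_invariants[OF eq] by auto
  obtain c where c: "gaps ((`) \<psi> ` S) = gaps S" "\<And>b. rim_odd ((`) \<psi> ` S) (b \<noteq> c) = rim_odd S b"
    using automorphism_invariants[OF \<psi> assms(2)] by blast
  show "gaps T = gaps S" using T c by (simp add: gaps_def)
  have "(\<exists>b. rim_odd ((`) \<psi> ` S) b) \<longleftrightarrow> (\<exists>b. rim_odd ((`) \<psi> ` S) (b \<noteq> c))"
    by (cases c) (auto simp: ex_bool_eq)
  then show "(\<exists>b. rim_odd T b) \<longleftrightarrow> (\<exists>b. rim_odd S b)" unfolding T(2) c(2) .
qed

subsection \<open>Normal forms of matchings of size two\<close>

abbreviation Ms :: "gp_vertex set set set" where
  "Ms \<equiv> matchings G 2"

abbreviation R :: "(gp_vertex set set \<times> gp_vertex set set) set" where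
  "R \<equiv> switching_iso_rel G Ms"

lemma equiv_R: "equiv Ms R"
  by (rule equiv_switching_iso_rel[OF simple]) (auto simp: matchings_def signatures_def)

lemma R_trans: "(S, T) \<in> R \<Longrightarrow> (T, W) \<in> R \<Longrightarrow> (S, W) \<in> R"
  using equiv_R by (meson equivE transD)

lemma R_switching: "S \<in> Ms \<Longrightarrow> T \<in> Ms \<Longrightarrow> switching_equivalent G S T \<Longrightarrow> (S, T) \<in> R"
  using automorphism_id[of G]
  by (auto simp: switching_iso_rel_def switching_isomorphic_def intro!: exI[of _ id])

lemma switching_equivalent_resign: "switching_equivalent G S (resign G (x b i) S)"
  unfolding switching_equivalent_def
  by (rule r_into_rtranclp, rule bexI[of _ "x b i"]) simp_all

lemma Ms_iff: "M \<in> Ms \<longleftrightarrow> (\<exists>e\<in>edges G. \<exists>f\<in>edges G. disjnt e f \<and> M = {e, f})"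
proof
  assume M: "M \<in> Ms"
  then obtain e f where "M = {e, f}" "e \<noteq> f" by (auto simp: matchings_def card_2_iff)
  with M show "\<exists>e\<in>edges G. \<exists>f\<in>edges G. disjnt e f \<and> M = {e, f}"
    by (auto simp: matchings_def pairwise_def)
next
  assume "\<exists>e\<in>edges G. \<exists>f\<in>edges G. disjnt e f \<and> M = {e, f}"
  then obtain e f where ef: "e \<in> edges G" "f \<in> edges G" "disjnt e f" "M = {e, f}" by blast
  \<comment> \<open>Edges are nonempty, so disjoint edges are distinct and the pair really has two
    elements.\<close>
  then have "card e = 2" using simple by (simp add: simple_graph_def)
  then have "e \<noteq> f" using ef by (auto simp: disjnt_def)
  then show "M \<in> Ms" using ef by (auto simp: matchings_def pairwise_def disjnt_sym)
qed

lemma pair_Ms: "e \<in> edges G \<Longrightarrow> f \<in> edges G \<Longrightarrow> disjnt e f \<Longrightarrow> {e, f} \<in> Ms"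
  using Ms_iff by blast

lemma disjnt_spoke_spoke: "disjnt (spoke i) (spoke j) \<longleftrightarrow> \<not> m dvd j - i"
  using dvd_diff_commute[of m i j] by (auto simp: disjnt_def spoke_def[of i] in_spoke_iff)

lemma disjnt_spoke_rim:
  "disjnt (spoke i) (rim b j) \<longleftrightarrow> \<not> m dvd j - i \<and> \<not> m dvd j - i + 1"
  using dvd_diff_commute[of m i j] dvd_diff_commute[of m i "j + 1"]
  by (cases b) (auto simp: disjnt_def spoke_def in_rim_iff algebra_simps)

lemma disjnt_rim_rim:
  "disjnt (rim b i) (rim c j) \<longleftrightarrow>
    b \<noteq> c \<or> \<not> m dvd j - i \<and> \<not> m dvd j - i + 1 \<and> \<not> m dvd j - i - 1"
  using dvd_diff_commute[of m i j] dvd_diff_commute[of m i "j + 1"] dvd_diff_commute[of m "i + 1" j]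
  by (auto simp: disjnt_def rim_def[of b] in_rim_iff algebra_simps)

lemma move_R:
  assumes "{e, f} \<in> Ms" "{move c a s ` e, move c a s ` f} \<in> Ms" "s = 1 \<or> s = -1"
  shows "({e, f}, {move c a s ` e, move c a s ` f}) \<in> R"
  using assms move_automorphism[of s c a] switching_equivalent_refl
  by (auto simp: switching_iso_rel_def switching_isomorphic_def)

text \<open>On a cycle of length \<open>2 * n + 1\<close> every index is within \<open>n\<close>
  steps of 0 in one direction; \<open>s\<close> records which.\<close>

lemma obtain_distance:
  fixes i :: int
  obtains d :: nat and s :: int where "d \<le> n" "s = 1 \<or> s = -1" "m dvd s * i - int d"
proof -
  obtain k where k: "k < 2 * n + 1" "m dvd i - int k"
    by (rule obtain_residue[of i]) blast
  show ?thesis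
  proof (cases "k \<le> n")
    case True
    then show ?thesis using k that[of k 1] by simp
  next
    case False
    have "- 1 * i - int (2 * n + 1 - k) = - (i - int k) - m"
      using k m by (simp add: of_nat_diff)
    then have "m dvd - 1 * i - int (2 * n + 1 - k)"
      using k by (metis dvd_diff dvd_minus_iff dvd_refl)
    moreover have "2 * n + 1 - k \<le> n" using False by simp
    ultimately show ?thesis using that[of "2 * n + 1 - k" "-1"] by blast
  qed
qed

text \<open>The types are numbered so that on \<open>reps\<close> the parity of \<open>k\<close>
  tells whether some rim is negative; see \<open>rim_odd_rep\<close>.\<close>

definition rep :: "nat \<Rightarrow> nat \<Rightarrow> gp_vertex set set" where
  "rep k d =
    (if k = 0 then {spoke 0, spoke (int d)}
     else if k = 1 then {spoke 0, rim True (int d)}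
     else if k = 2 then {rim True 0, rim True (int d)}
     else {rim True 0, rim False (int d)})"

text \<open>Two rim edges at distance 2 on the same cycle are omitted: they switch to \<open>rep 0 1\<close>.\<close>

definition reps :: "(nat \<times> nat) set" where
  "reps = (SIGMA k:{0, 1, 2, 3}. {(if k = 2 then 3 else if k = 3 then 0 else 1)..n})"

text \<open>The range fits the gap computations: \<open>t\<close> and \<open>d\<close> are at most
  \<open>n\<close> and face indices differ by at most \<open>d + 1\<close>, so
  \<open>t - (q - p)\<close> lies between \<open>- n - 1\<close> and
  \<open>2 * n + 1\<close>.\<close>

lemma dvd_iff: "m dvd z \<longleftrightarrow> z = 0 \<or> z = 2 * int n + 1"
  if "- int n - 1 \<le> z" "z \<le> 2 * int n + 1"
  using that m n4 dvd_medium[of z] by auto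

lemma rep_Ms:
  assumes "d \<le> n" "k = 0 \<or> k = 1 \<Longrightarrow> 1 \<le> d" "k = 2 \<Longrightarrow> 2 \<le> d"
  shows "rep k d \<in> Ms"
proof -
  have "disjnt (spoke 0) (spoke (int d))" if "k = 0"
    using that assms by (auto simp: disjnt_spoke_spoke dvd_iff)
  moreover have "disjnt (spoke 0) (rim True (int d))" if "k = 1"
    using that assms by (auto simp: disjnt_spoke_rim dvd_iff)
  moreover have "disjnt (rim True 0) (rim True (int d))" if "k = 2"
    using that assms by (auto simp: disjnt_rim_rim dvd_iff)
  moreover have "disjnt (rim True 0) (rim False (int d))"
    by (simp add: disjnt_rim_rim)
  ultimately show ?thesis
    unfolding rep_def by (auto intro!: pair_Ms)
qed

text \<open>A rotation or reflection takes \<open>spoke i\<close> to index 0 and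
  \<open>spoke j\<close> to its cyclic distance. The extra clause about \<open>d = 1\<close> serves
  \<open>R_two_apart\<close>.\<close>

lemma R_spokes:
  assumes "{spoke i, spoke j} \<in> Ms" "\<not> m dvd j - i"
  shows "\<exists>d\<in>{1..n}. ({spoke i, spoke j}, rep 0 d) \<in> R \<and> (m dvd j - i - 1 \<longrightarrow> d = 1)"
proof -
  obtain d s where d: "d \<le> n" and s: "s = 1 \<or> s = -1" and dvd: "m dvd s * (j - i) - int d"
    by (rule obtain_distance)
  have "d \<noteq> 0"
    by (rule notI) (use dvd s assms(2) dvd_diff_commute[of m i j] in auto)
  have "move False (- s * i) s ` spoke i = spoke 0"
    by (simp add: move_spoke)
  moreover have "move False (- s * i) s ` spoke j = spoke (int d)"
    using dvd by (simp add: move_spoke algebra_simps)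
  moreover have "rep 0 d \<in> Ms" using d \<open>d \<noteq> 0\<close> by (intro rep_Ms) auto
  ultimately have "({spoke i, spoke j}, rep 0 d) \<in> R"
    using move_R[OF assms(1) _ s, of False "- s * i"] by (simp add: rep_def)
  moreover have "d = 1" if "m dvd j - i - 1"
  proof -
    have "m dvd s * (j - i) - int d - s * (j - i - 1)"
      by (rule dvd_diff[OF dvd]) (use that in simp)
    then have "m dvd s - int d" by (simp add: algebra_simps)
    then show ?thesis using s d \<open>d \<noteq> 0\<close> by (auto simp: dvd_iff)
  qed
  ultimately show ?thesis using d \<open>d \<noteq> 0\<close> by auto
qed

text \<open>The reflection fixing the spoke sends offset \<open>k\<close> of the rim edge to
  \<open>2 * n - k\<close>. The offsets 0 and \<open>2 * n\<close> are excluded because those rim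
  edges touch the spoke; one of \<open>k\<close> and \<open>2 * n - k\<close> is at most
  \<open>n\<close>.\<close>

lemma R_spoke_rim:
  assumes M: "{spoke i, rim b j} \<in> Ms" and "\<not> m dvd j - i" "\<not> m dvd j - i + 1"
  shows "\<exists>d\<in>{1..n}. ({spoke i, rim b j}, rep 1 d) \<in> R"
proof -
  obtain k where k: "k < 2 * n + 1" "m dvd j - i - int k"
    by (rule obtain_residue[of "j - i"]) blast
  have "k \<noteq> 0" by (rule notI) (use k assms in auto)
  have "k \<noteq> 2 * n"
  proof
    assume "k = 2 * n"
    then have "j - i + 1 = j - i - int k + m" using m by simp
    then show False using k assms by (metis dvd_add dvd_refl)
  qed
  show ?thesis
  proof (cases "k \<le> n")
    case True
    have "move (\<not> b) (- i) 1 ` spoke i = spoke 0" "move (\<not> b) (- i) 1 ` rim b j = rim True (int k)"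
      using k by (simp_all add: move_spoke move_rim)
    moreover have "rep 1 k \<in> Ms" using True \<open>k \<noteq> 0\<close> by (intro rep_Ms) auto
    ultimately have "({spoke i, rim b j}, rep 1 k) \<in> R"
      using move_R[OF M, of "\<not> b" "- i" 1] by (simp add: rep_def)
    then show ?thesis using True \<open>k \<noteq> 0\<close> by auto
  next
    case False
    let ?d = "2 * n - k"
    have d: "1 \<le> ?d" "?d \<le> n" using False k \<open>k \<noteq> 2 * n\<close> by auto
    have "i - j - 1 - int ?d = - (j - i - int k) - m"
      using k m by (simp add: of_nat_diff)
    then have "m dvd i - j - 1 - int ?d"
      using k by (metis dvd_diff dvd_minus_iff dvd_refl)
    then have "move (\<not> b) i (-1) ` spoke i = spoke 0" "move (\<not> b) i (-1) ` rim b j = rim True (int ?d)"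
      by (simp_all add: move_spoke move_rim)
    moreover have "rep 1 ?d \<in> Ms" using d by (intro rep_Ms) auto
    ultimately have "({spoke i, rim b j}, rep 1 ?d) \<in> R"
      using move_R[OF M, of "\<not> b" i "-1"] by (simp add: rep_def)
    then show ?thesis using d by auto
  qed
qed

text \<open>Resigning at \<open>x True 1\<close> and \<open>x True 2\<close> removes the rim edges 0
  and 2, toggles the edge between the two vertices twice, and adds the spokes 1 and 2.\<close>

lemma R_two_apart: "(rep 2 2, rep 0 1) \<in> R"
proof -
  have "2 \<le> n" using n4 by simp
  then have M2: "rep 2 2 \<in> Ms" by (intro rep_Ms) auto
  have M1: "{spoke 1, spoke 2} \<in> Ms"
    by (intro pair_Ms spoke_edge, unfold disjnt_spoke_spoke) (use m n4 dvd_small[of 1] in simp)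
  have "e \<in> resign G (x True 2) (resign G (x True 1) (rep 2 2)) \<longleftrightarrow> e \<in> {spoke 1, spoke 2}" for e
  proof (cases "e \<in> edges G")
    case True
    then consider b i where "e = rim b i" | i where "e = spoke i" by (auto simp: edges_iff)
    then show ?thesis
    proof cases
      case 1
      have "\<not> (m dvd i \<and> m dvd i - 1)" "\<not> (m dvd i - 1 \<and> m dvd i - 2)" "\<not> (m dvd i \<and> m dvd i - 2)"
        using m n4 by (rule_tac [!] dvd_exclusive) auto
      then show ?thesis
        using dvd_diff_commute[of m 1 i] dvd_diff_commute[of m 2 i]
        by (auto simp: 1 in_resign_iff rep_def in_rim_iff)
    next
      case 2
      have "\<not> (m dvd i - 1 \<and> m dvd i - 2)"
        using m n4 by (intro dvd_exclusive) auto
      then show ?thesis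
        using dvd_diff_commute[of m 1 i] dvd_diff_commute[of m 2 i]
        by (auto simp: 2 in_resign_iff rep_def in_spoke_iff)
    qed
  next
    case False
    moreover have "rep 2 2 \<subseteq> edges G" using M2 by (simp add: matchings_def)
    then have "resign G (x True 2) (resign G (x True 1) (rep 2 2)) \<subseteq> edges G"
      by (intro resign_subset)
    moreover have "{spoke 1, spoke 2} \<subseteq> edges G" by simp
    ultimately show ?thesis by blast
  qed
  then have "{spoke 1, spoke 2} = resign G (x True 2) (resign G (x True 1) (rep 2 2))" by blast
  then have "switching_equivalent G (rep 2 2) {spoke 1, spoke 2}"
    by (metis switching_equivalent_resign switching_equivalent_trans)
  then have "(rep 2 2, {spoke 1, spoke 2}) \<in> R"
    by (rule R_switching[OF M2 M1])
  moreover have "({spoke 1, spoke 2}, rep 0 1) \<in> R"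
  proof -
    have "\<not> m dvd 2 - 1" using m n4 dvd_small[of 1] by simp
    from R_spokes[OF M1 this] show ?thesis by auto
  qed
  ultimately show ?thesis by (rule R_trans)
qed

lemma R_rims:
  assumes M: "{rim b i, rim c j} \<in> Ms"
    and bc: "b = c \<Longrightarrow> \<not> m dvd j - i \<and> \<not> m dvd j - i + 1 \<and> \<not> m dvd j - i - 1"
  shows "\<exists>d\<le>n. (b \<noteq> c \<or> 2 \<le> d) \<and> ({rim b i, rim c j}, rep (if b = c then 2 else 3) d) \<in> R"
proof -
  obtain d s where d: "d \<le> n" and s: "s = 1 \<or> s = -1" and dvd: "m dvd s * (j - i) - int d"
    by (rule obtain_distance)
  have d2: "b \<noteq> c \<or> 2 \<le> d"
  proof (rule ccontr)
    assume "\<not> (b \<noteq> c \<or> 2 \<le> d)"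
    then have "b = c" "d = 0 \<or> d = 1" by auto
    with bc s dvd show False
      using dvd_minus_iff[of m "j - i"] dvd_minus_iff[of m "j - i + 1"] by (auto simp: algebra_simps)
  qed
  \<comment> \<open>A reflection sends \<open>rim b i\<close> to index \<open>a - i - 1\<close>, so
    \<open>i + 1\<close> is the value that puts it at 0.\<close>
  define a where "a = (if s = 1 then - i else i + 1)"
  have "move (\<not> b) a s ` rim b i = rim True 0"
    using s by (elim disjE) (simp_all add: a_def move_rim)
  moreover have "move (\<not> b) a s ` rim c j = rim (b = c) (int d)"
    using s dvd by (elim disjE) (auto simp add: a_def move_rim algebra_simps)
  moreover have "rep (if b = c then 2 else 3) d \<in> Ms" using d d2 by (intro rep_Ms) auto
  ultimately have "({rim b i, rim c j}, rep (if b = c then 2 else 3) d) \<in> R"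
    using move_R[OF M _ s, of "\<not> b" a] by (cases "b = c") (simp_all add: rep_def)
  then show ?thesis using d d2 by blast
qed

lemma R_rep:
  assumes M: "M \<in> Ms"
  shows "\<exists>(k, d)\<in>reps. (M, rep k d) \<in> R"
proof -
  obtain e f where "e \<in> edges G" "f \<in> edges G" and disj: "disjnt e f" and ef: "M = {e, f}"
    using M unfolding Ms_iff by blast
  \<comment> \<open>In the mixed case either \<open>e\<close> or \<open>f\<close> may be the spoke;
    stating it for \<open>M\<close> covers both orders.\<close>
  then consider (ss) i j where "e = spoke i" "f = spoke j"
    | (sr) i b j where "M = {spoke i, rim b j}" "disjnt (spoke i) (rim b j)"
    | (rr) b i c j where "e = rim b i" "f = rim c j"
    unfolding edges_iff by (metis disjnt_sym insert_commute)
  then show ?thesis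
  proof cases
    case ss
    then obtain d where "d \<in> {1..n}" "(M, rep 0 d) \<in> R"
      using R_spokes[of i j] M disj ef unfolding ss disjnt_spoke_spoke by blast
    then show ?thesis by (intro bexI[of _ "(0, d)"]) (auto simp: reps_def)
  next
    case sr
    then obtain d where "d \<in> {1..n}" "(M, rep 1 d) \<in> R"
      using R_spoke_rim[of i b j] M unfolding sr disjnt_spoke_rim by blast
    then show ?thesis by (intro bexI[of _ "(1, d)"]) (auto simp: reps_def)
  next
    case rr
    then obtain d where d: "d \<le> n" "b \<noteq> c \<or> 2 \<le> d" "(M, rep (if b = c then 2 else 3) d) \<in> R"
      using R_rims[of b i c j] M disj ef unfolding rr disjnt_rim_rim by blast
    consider "b \<noteq> c" | "b = c" "d = 2" | "b = c" "3 \<le> d" using d by fastforce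
    then show ?thesis
    proof cases
      case 1
      then show ?thesis using d by (intro bexI[of _ "(3, d)"]) (auto simp: reps_def)
    next
      case 2
      then have "(M, rep 0 1) \<in> R"
        using d R_trans[OF _ R_two_apart] by simp
      then show ?thesis using n4 by (intro bexI[of _ "(0, 1)"]) (auto simp: reps_def)
    next
      case 3
      then show ?thesis using d by (intro bexI[of _ "(2, d)"]) (auto simp: reps_def)
    qed
  qed
qed

subsection \<open>Invariants of the normal forms\<close>

text \<open>Once the negative faces are listed by residues \<open>P\<close>, the gaps are the
  differences of \<open>P\<close> modulo \<open>m\<close>.\<close>

lemma gaps_iff:
  assumes "\<And>i. neg_face S i \<longleftrightarrow> (\<exists>p\<in>P. m dvd i - p)"
  shows "t \<in> gaps S \<longleftrightarrow> (\<exists>p\<in>P. \<exists>q\<in>P. m dvd t - (q - p))"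
proof
  assume "t \<in> gaps S"
  then obtain i p q where pq: "p \<in> P" "m dvd i - p" "q \<in> P" "m dvd i + t - q"
    by (auto simp: gaps_def assms)
  then have "m dvd (i + t - q) - (i - p)" by (metis dvd_diff)
  then have "m dvd t - (q - p)" by (simp add: algebra_simps)
  then show "\<exists>p\<in>P. \<exists>q\<in>P. m dvd t - (q - p)" using pq by blast
next
  assume "\<exists>p\<in>P. \<exists>q\<in>P. m dvd t - (q - p)"
  then obtain p q where pq: "p \<in> P" "q \<in> P" "m dvd t - (q - p)" by blast
  then have "neg_face S p" unfolding assms by (intro bexI[of _ p]) simp_all
  moreover have "neg_face S (p + t)"
    unfolding assms using pq by (intro bexI[of _ q]) (simp_all add: algebra_simps)
  ultimately show "t \<in> gaps S" by (auto simp: gaps_def)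
qed

text \<open>Each spoke makes the faces on both its sides negative, and for \<open>d \<ge> 2\<close>
  these four faces are distinct.\<close>

lemma gaps_rep_0:
  assumes "2 \<le> d" "d \<le> n" "t \<le> n"
  shows "int t \<in> gaps (rep 0 d) \<longleftrightarrow> t \<in> {0, 1, d - 1, d, d + 1}"
proof -
  have "neg_face (rep 0 d) i \<longleftrightarrow> (\<exists>p\<in>{0, -1, int d, int d - 1}. m dvd i - p)" for i
  proof -
    have "\<not> (m dvd i \<and> m dvd i + 1)" "\<not> (m dvd i - int d \<and> m dvd i + 1 - int d)"
      "\<not> (m dvd i \<and> m dvd i + 1 - int d)" "\<not> (m dvd i + 1 \<and> m dvd i - int d)"
      using m n4 assms by (rule_tac [!] dvd_exclusive) auto
    then show ?thesis by (auto simp: neg_face_def rep_def algebra_simps)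
  qed
  from gaps_iff[OF this] show ?thesis using assms by (auto simp: dvd_iff)
qed

text \<open>The signs cancel on the face between the two spokes, leaving the faces -1 and 1.\<close>

lemma gaps_rep_0_1:
  assumes "t \<le> n"
  shows "int t \<in> gaps (rep 0 1) \<longleftrightarrow> t \<in> {0, 2}"
proof -
  have "neg_face (rep 0 1) i \<longleftrightarrow> (\<exists>p\<in>{-1, 1}. m dvd i - p)" for i
  proof -
    have "\<not> (m dvd i \<and> m dvd i + 1)" "\<not> (m dvd i \<and> m dvd i - 1)" "\<not> (m dvd i + 1 \<and> m dvd i - 1)"
      using m n4 by (rule_tac [!] dvd_exclusive) auto
    then show ?thesis by (auto simp: neg_face_def rep_def algebra_simps)
  qed
  from gaps_iff[OF this] show ?thesis using assms n4 by (auto simp: dvd_iff)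
qed

text \<open>The spoke contributes the faces -1 and 0, the rim edge the single face
  \<open>d\<close>.\<close>

lemma gaps_rep_1:
  assumes "1 \<le> d" "d \<le> n" "t \<le> n"
  shows "int t \<in> gaps (rep 1 d) \<longleftrightarrow> t \<in> {0, 1, d, d + 1}"
proof -
  have "neg_face (rep 1 d) i \<longleftrightarrow> (\<exists>p\<in>{0, -1, int d}. m dvd i - p)" for i
  proof -
    have "\<not> (m dvd i \<and> m dvd i + 1)" "\<not> (m dvd i \<and> m dvd i - int d)"
      "\<not> (m dvd i + 1 \<and> m dvd i - int d)"
      using m n4 assms by (rule_tac [!] dvd_exclusive) auto
    then show ?thesis by (auto simp: neg_face_def rep_def algebra_simps)
  qed
  from gaps_iff[OF this] show ?thesis using assms by (auto simp: dvd_iff)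
qed

lemma gaps_rep_2_3:
  assumes "k = 2 \<or> k = 3" "1 \<le> d" "d \<le> n" "t \<le> n"
  shows "int t \<in> gaps (rep k d) \<longleftrightarrow> t \<in> {0, d}"
proof -
  have "neg_face (rep k d) i \<longleftrightarrow> (\<exists>p\<in>{0, int d}. m dvd i - p)" for i
  proof -
    have "\<not> (m dvd i \<and> m dvd i - int d)"
      using m n4 assms by (intro dvd_exclusive) auto
    then show ?thesis using assms(1) by (auto simp: neg_face_def rep_def)
  qed
  from gaps_iff[OF this] show ?thesis using assms by (auto simp: dvd_iff)
qed

text \<open>Both edges lie on the same face, where they cancel.\<close>

lemma gaps_rep_3_0: "gaps (rep 3 0) = {}"
  by (auto simp: gaps_def neg_face_def rep_def)

text \<open>Type 1 has one edge on a rim, type 2 two on the same rim, and type 3 one on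
  each.\<close>

lemma rim_odd_rep:
  assumes "(k, d) \<in> reps"
  shows "(\<exists>b. rim_odd (rep k d) b) \<longleftrightarrow> odd k"
proof -
  have mem: "rim c i \<in> range (rim b) \<longleftrightarrow> b = c" "spoke i \<notin> range (rim b)" for b c i
    by (auto simp: image_iff intro: exI[of _ i])
  have "rim True 0 \<noteq> rim True (int d)" if "k = 2"
    unfolding rim_eq_iff using that assms by (auto simp: reps_def dvd_iff)
  moreover have "k = 0 \<or> k = 1 \<or> k = 2 \<or> k = 3" using assms by (auto simp: reps_def)
  ultimately show ?thesis
    by (elim disjE) (simp_all add: rim_odd_def rep_def Int_insert_left mem ex_bool_eq del: rim_eq_iff)
qed

lemma reps_Ms: "(k, d) \<in> reps \<Longrightarrow> rep k d \<in> Ms"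
  by (rule rep_Ms) (auto simp: reps_def split: if_splits)

text \<open>A table of the gaps to be read only for \<open>t \<le> n\<close>; the entry
  \<open>d + 1\<close> may lie beyond that range.\<close>

definition rep_gaps :: "nat \<Rightarrow> nat \<Rightarrow> nat set" where
  "rep_gaps k d =
    (if k = 0 then (if d = 1 then {0, 2} else {0, 1, d - 1, d, d + 1})
     else if k = 1 then {0, 1, d, d + 1}
     else if k = 3 \<and> d = 0 then {} else {0, d})"

lemma gaps_rep:
  assumes "(k, d) \<in> reps" "t \<le> n"
  shows "int t \<in> gaps (rep k d) \<longleftrightarrow> t \<in> rep_gaps k d"
proof -
  have "k = 0 \<and> d = 1 \<or> k = 0 \<and> 2 \<le> d \<or> k = 1 \<and> 1 \<le> d \<or> k = 2 \<and> 1 \<le> d \<or>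
    k = 3 \<and> d = 0 \<or> k = 3 \<and> 1 \<le> d" and "d \<le> n"
    using assms by (auto simp: reps_def)
  then show ?thesis
    using assms gaps_rep_0[of d t] gaps_rep_0_1[of t] gaps_rep_1[of d t] gaps_rep_2_3[of k d t]
      gaps_rep_3_0
    by (elim disjE) (simp_all add: rep_gaps_def)
qed

section \<open>Separating the normal forms by their gaps\<close>

lemma rep_gaps_0_distinct:
  assumes "1 \<le> d" "d < d'" "d' \<le> n"
  shows "\<exists>t\<le>n. (t \<in> rep_gaps 0 d) \<noteq> (t \<in> rep_gaps 0 d')"
proof -
  \<comment> \<open>For \<open>d \<ge> 3\<close> the smallest gap above 1 is \<open>d - 1\<close>,
    which determines \<open>d\<close>; for \<open>d = 2\<close> it merges with 1.\<close>
  consider "d = 1" | "3 \<le> d" | "d = 2" "d' = 3" | "d = 2" "4 \<le> d'" using assms by linarith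
  then show ?thesis
  proof cases
    case 1
    then show ?thesis using assms n4 by (intro exI[of _ 1]) (auto simp: rep_gaps_def)
  next
    case 2
    then show ?thesis using assms by (intro exI[of _ "d - 1"]) (auto simp: rep_gaps_def)
  next
    case 3
    \<comment> \<open>The gap sets {0, 1, 2, 3} and {0, 1, 2, 3, 4} differ only in 4, which is in
      range because \<open>n \<ge> 4\<close>.\<close>
    then show ?thesis using n4 by (intro exI[of _ 4]) (auto simp: rep_gaps_def)
  next
    case 4
    then show ?thesis using assms by (intro exI[of _ d']) (auto simp: rep_gaps_def)
  qed
qed

text \<open>For \<open>d \<ge> 2\<close> the smallest gap above 1 is \<open>d\<close>; for
  \<open>d = 1\<close> the gaps are just 0, 1 and 2.\<close>

lemma rep_gaps_1_distinct:
  assumes "1 \<le> d" "d < d'" "d' \<le> n"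
  shows "\<exists>t\<le>n. (t \<in> rep_gaps 1 d) \<noteq> (t \<in> rep_gaps 1 d')"
proof -
  consider "2 \<le> d" | "d = 1" "d' = 2" | "d = 1" "3 \<le> d'" using assms by linarith
  then show ?thesis
  proof cases
    case 1
    then show ?thesis using assms by (intro exI[of _ d]) (auto simp: rep_gaps_def)
  next
    case 2
    then show ?thesis using n4 by (intro exI[of _ 3]) (auto simp: rep_gaps_def)
  next
    case 3
    then show ?thesis using assms by (intro exI[of _ d']) (auto simp: rep_gaps_def)
  qed
qed

lemma rep_gaps_distinct:
  assumes "(k, d) \<in> reps" "(k', d') \<in> reps" "odd k \<longleftrightarrow> odd k'" "k < k' \<or> k = k' \<and> d < d'"
  shows "\<exists>t\<le>n. (t \<in> rep_gaps k d) \<noteq> (t \<in> rep_gaps k' d')"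
proof -
  have d: "d \<le> n" "d' \<le> n" "k < 2 \<longrightarrow> 1 \<le> d" "k = 2 \<longrightarrow> 3 \<le> d" "k' = 2 \<longrightarrow> 3 \<le> d'"
    using assms by (auto simp: reps_def split: if_splits)
  have "k \<in> {0, 1, 2, 3}" "k' \<in> {0, 1, 2, 3}" using assms by (auto simp: reps_def)
  then consider "k = 0" "k' = 0" "d < d'" | "k = 1" "k' = 1" "d < d'" | "k = 2" "k' = 2" "d < d'"
    | "k = 3" "k' = 3" "d < d'" | "k = 0" "k' = 2" | "k = 1" "k' = 3"
    using assms(3,4) by auto
  then show ?thesis
  proof cases
    case 1
    then show ?thesis using d rep_gaps_0_distinct by simp
  next
    case 2
    then show ?thesis using d rep_gaps_1_distinct by simp
  next
    case 3
    then show ?thesis using d by (intro exI[of _ d]) (auto simp: rep_gaps_def)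
  next
    case 4
    then show ?thesis using d by (intro exI[of _ d']) (auto simp: rep_gaps_def)
  next
    case 5
    \<comment> \<open>The gaps of \<open>rep 0 1\<close> are 0 and 2, and no type 2 form in
      \<open>reps\<close> has gap 2, since distance 2 is omitted there. All other two-spoke forms
      have gap 1, which type 2 lacks.\<close>
    then show ?thesis using d n4 by (intro exI[of _ "if d = 1 then 2 else 1"]) (auto simp: rep_gaps_def)
  next
    case 6
    \<comment> \<open>Type 1 always has gap 1, type 3 only for \<open>d' = 1\<close>; there type 1
      has a further gap, 2 or \<open>d\<close>.\<close>
    then show ?thesis
      using d n4 by (intro exI[of _ "if d' \<noteq> 1 then 1 else if d = 1 then 2 else d"]) (auto simp: rep_gaps_def)
  qed
qed

text \<open>The rim signs force \<open>k\<close> and \<open>k'\<close> to have the same parity, and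
  the gaps up to \<open>n\<close> separate the remaining pairs.\<close>

lemma rep_distinct:
  assumes "(k, d) \<in> reps" "(k', d') \<in> reps" "(rep k d, rep k' d') \<in> R"
  shows "(k, d) = (k', d')"
proof (rule ccontr)
  assume "(k, d) \<noteq> (k', d')"
  then have lt: "k < k' \<or> k = k' \<and> d < d' \<or> k' < k \<or> k' = k \<and> d' < d" by auto
  have "switching_isomorphic G (rep k d) (rep k' d')" "rep k d \<subseteq> edges G"
    using assms by (auto simp: switching_iso_rel_def matchings_def)
  from switching_isomorphic_invariants[OF this]
  have gaps: "gaps (rep k d) = gaps (rep k' d')" and odd: "odd k \<longleftrightarrow> odd k'"
    using rim_odd_rep assms by auto
  have "t \<in> rep_gaps k d \<longleftrightarrow> t \<in> rep_gaps k' d'" if "t \<le> n" for t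
    using gaps_rep[OF assms(1) that] gaps_rep[OF assms(2) that] gaps by simp
  then show False
    using lt odd rep_gaps_distinct[OF assms(1,2)] rep_gaps_distinct[OF assms(2,1)] by blast
qed

section \<open>Counting the classes\<close>

lemma card_reps: "card reps = 4 * n - 1"
  \<comment> \<open>The types 0 to 3 contribute \<open>n\<close>, \<open>n\<close>,
    \<open>n - 2\<close> and \<open>n + 1\<close> forms.\<close>
  using n4 by (simp add: reps_def)

lemma card_classes: "card (Ms // R) = 4 * n - 1"
proof -
  have "bij_betw (\<lambda>(k, d). R `` {rep k d}) reps (Ms // R)"
  proof (intro bij_betwI' ballI)
    fix p q assume p: "p \<in> reps" "q \<in> reps"
    obtain k d k' d' where pq: "p = (k, d)" "q = (k', d')" by fastforce
    show "(case p of (k, d) \<Rightarrow> R `` {rep k d}) = (case q of (k, d) \<Rightarrow> R `` {rep k d}) \<longleftrightarrow> p = q"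
      using p rep_distinct[of k d k' d'] eq_equiv_class[OF _ equiv_R, of "rep k d" "rep k' d'"]
        reps_Ms[of k' d'] by (auto simp: pq)
  next
    fix p assume "p \<in> reps"
    then show "(case p of (k, d) \<Rightarrow> R `` {rep k d}) \<in> Ms // R"
      by (cases p) (auto intro!: quotientI reps_Ms)
  next
    fix X assume "X \<in> Ms // R"
    then obtain M where "M \<in> Ms" "X = R `` {M}" by (rule quotientE)
    moreover from this obtain k d where "(k, d) \<in> reps" "(M, rep k d) \<in> R" using R_rep by blast
    ultimately have "X = R `` {rep k d}" using equiv_class_eq[OF equiv_R] by simp
    with \<open>(k, d) \<in> reps\<close> show "\<exists>p\<in>reps. X = (case p of (k, d) \<Rightarrow> R `` {rep k d})"
      by (intro bexI[of _ "(k, d)"]) simp_all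
  qed
  then show ?thesis using bij_betw_same_card card_reps by metis
qed

end

theorem theorem10:
  fixes n :: nat
  assumes "n \<ge> 4"
  shows "card (matchings (gen_petersen (2 * n + 1) 1) 2 //
           switching_iso_rel (gen_petersen (2 * n + 1) 1)
             (matchings (gen_petersen (2 * n + 1) 1) 2)) = 4 * n - 1"
proof -
  interpret odd_prism n "2 * int n + 1"
    using assms by unfold_locales simp_all
  show ?thesis using card_classes unfolding G_def .
qed

end
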